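(* For each $n\ge1$ let $S_n=\sum_{k=1}^nX_{kn}$, where $X_{1n},X_{2n},\ldots,X_{nn}$ are i.i.d. nonnegative integer-valued random variables, and assume that, as $n\to\infty$, $X_{1n}\Rightarrow X$ and $\mathbb{E}X_{1n}\to\mathbb{E}X$, where $\mathbb{E}X<\infty$. Also assume that $a_n\in[0,1]$ with $na_n\to\lambda\in(0,\infty)$ as $n\to\infty$. Then $$a_n\circ S_n\Rightarrow N(\lambda\,\mathbb{E}X),\qquad n\to\infty .$$
   Context: Notation. $\Rightarrow$ denotes convergence in distribution. For a nonnegative integer-valued random variable $Z$ and $\alpha\in[0,1]$, $\alpha\circ Z$ denotes a random variable distributed as $\sum_{i=1}^Z B_i$ (empty sum $=0$), where $B_1,B_2,\ldots$ are i.i.d. with $P(B_i=1)=\alpha=1-P(B_i=0)$, independent of $Z$. $\{N(t):t\ge0\}$ is a Poisson process with rate $1$, so for a constant $c\ge0$, $N(c)$ has the Poisson distribution with mean $c$ (the constant $0$ when $c=0$). *)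

theory Defs
  imports "HOL-Probability.Probability"
begin

abbreviation law :: "'a measure \<Rightarrow> ('a \<Rightarrow> nat) \<Rightarrow> nat measure" where
  "law M Z \<equiv> distr M (count_space UNIV) Z"

(* Convergence in distribution depends only on the laws; the laws on nat are
   pushed forward to the reals, where weak_conv_m is defined through cdfs. *)
definition conv_in_law :: "(nat \<Rightarrow> nat measure) \<Rightarrow> nat measure \<Rightarrow> bool" where
  "conv_in_law \<mu> \<nu> \<longleftrightarrow> weak_conv_m (\<lambda>n. distr (\<mu> n) borel real) (distr \<nu> borel real)"

(* The law of the thinned variable, as a function of the law \<mu> of Z: on the product
   space, z has law \<mu> and is independent of the i.i.d. Bernoulli sequence B. *)
definition thinning :: "real \<Rightarrow> nat measure \<Rightarrow> nat measure" where
  "thinning \<alpha> \<mu> =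
     distr (\<mu> \<Otimes>\<^sub>M (\<Pi>\<^sub>M i\<in>(UNIV :: nat set). measure_pmf (bernoulli_pmf \<alpha>)))
       (count_space UNIV) (\<lambda>(z, B). \<Sum>i = 1..z. of_bool (B i))"

(* poisson_pmf is only specified for a positive rate; rate 0 is the point mass at 0. *)
definition poisson_law :: "real \<Rightarrow> nat measure" where
  "poisson_law c = measure_pmf (if c = 0 then return_pmf 0 else poisson_pmf c)"

end

theory Submission
  imports Defs
begin

text \<open>
  The idea is to compute with generating functions \<open>z \<mapsto> E (z ^ Z)\<close> on the closed complex unit
  disc and to read off convergence in distribution from their values on the unit circle, where
  they are the characteristic functions, by Levy's continuity theorem.

  Thinning by \<open>a\<close> acts on generating functions by precomposition with the affine map
  \<open>z \<mapsto> 1 + a (z - 1)\<close>, and independent sums multiply generating functions.  Hence the generating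
  function of the thinned sum at \<open>z\<close> is \<open>\<phi>\<^sub>n(u\<^sub>n) ^ n\<close>, where \<open>\<phi>\<^sub>n\<close> belongs to one summand
  and \<open>u\<^sub>n = 1 + a\<^sub>n (z - 1)\<close> stays in the disc and tends to \<open>1\<close>.  The Poisson limit has the
  generating function \<open>exp (l E(Y) (z - 1))\<close>, so by \<open>power_tendsto_exp\<close> it suffices that
  \<open>n (\<phi>\<^sub>n(u\<^sub>n) - 1)\<close> tends to \<open>l E(Y) (z - 1)\<close>.  Expanding \<open>u ^ k - 1\<close> as
  \<open>u - 1\<close> times a geometric sum gives
  \<open>n (\<phi>\<^sub>n(u\<^sub>n) - 1) = (n a\<^sub>n) (z - 1) E (\<Sum>j<X\<^sub>n. u\<^sub>n ^ j)\<close>.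

  What remains is that this last expectation tends to \<open>E(Y)\<close>
  (\<open>geometric_sum_mean_tendsto\<close>).  This is where the convergence of the means enters: the sum has
  modulus at most \<open>X\<^sub>n\<close>, and by Scheffe's lemma the functions \<open>k \<mapsto> k P(X\<^sub>n = k)\<close>, which
  converge pointwise and whose sums converge to that of the limit, converge in \<open>L\<^sup>1\<close>.
\<close>

section \<open>Generating functions on the closed unit disc\<close>

definition pgf :: "nat measure \<Rightarrow> complex \<Rightarrow> complex" where
  "pgf \<mu> z = (\<integral>k. z ^ k \<partial>\<mu>)"

lemma integrable_power_disc:
  fixes f :: "'a \<Rightarrow> nat" and z :: complex
  assumes "prob_space M" "f \<in> measurable M (count_space UNIV)" "norm z \<le> 1"
  shows "integrable M (\<lambda>\<omega>. z ^ f \<omega>)"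
proof -
  interpret prob_space M by fact
  note assms(2)[measurable]
  show ?thesis
  proof (rule integrable_const_bound[where B = 1])
    show "AE \<omega> in M. norm (z ^ f \<omega>) \<le> 1"
      using assms(3) by (simp add: norm_power power_le_one)
    show "(\<lambda>\<omega>. z ^ f \<omega>) \<in> borel_measurable M"
      using assms(2) by (rule measurable_compose) simp
  qed
qed

lemma pgf_law:
  assumes "f \<in> measurable M (count_space UNIV)"
  shows "pgf (law M f) z = (\<integral>\<omega>. z ^ f \<omega> \<partial>M)"
  unfolding pgf_def using assms by (subst integral_distr) auto

lemma measurable_discrete:
  fixes f :: "nat \<Rightarrow> 'b"
  assumes "sets \<mu> = UNIV" "space N = UNIV"
  shows "f \<in> measurable \<mu> N"
  using assms sets_eq_imp_space_eq[of \<mu> "count_space UNIV"] by (auto simp: measurable_def)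

lemma norm_pgf_le_1:
  assumes "prob_space \<mu>" "sets \<mu> = UNIV" "norm z \<le> 1"
  shows "norm (pgf \<mu> z) \<le> 1"
proof -
  interpret prob_space \<mu> by fact
  have m: "(\<lambda>k. k) \<in> measurable \<mu> (count_space UNIV)"
    using assms(2) by (rule measurable_discrete) simp
  have "norm (pgf \<mu> z) \<le> (\<integral>k. norm (z ^ k) \<partial>\<mu>)"
    unfolding pgf_def by (rule integral_norm_bound)
  also have "\<dots> \<le> (\<integral>k. 1 \<partial>\<mu>)"
    using assms(3) integrable_power_disc[OF assms(1) m assms(3)]
    by (intro integral_mono integrable_norm) (simp_all add: norm_power power_le_one)
  finally show ?thesis by (simp add: prob_space)
qed

text \<open>
  Factoring out \<open>z - 1\<close> isolates the factor that is small when \<open>z\<close> is close to \<open>1\<close>; the remaining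
  geometric sum is an approximation of \<open>k\<close> that is bounded by \<open>k\<close>.
\<close>

lemma pgf_diff_1:
  assumes "prob_space \<mu>" "sets \<mu> = UNIV" "norm z \<le> 1"
  shows "pgf \<mu> z - 1 = (z - 1) * (\<integral>k. (\<Sum>j<k. z ^ j) \<partial>\<mu>)"
proof -
  interpret prob_space \<mu> by fact
  have m: "(\<lambda>k. k) \<in> measurable \<mu> (count_space UNIV)"
    using assms(2) by (rule measurable_discrete) simp
  have "pgf \<mu> z - 1 = (\<integral>k. z ^ k - 1 \<partial>\<mu>)"
    unfolding pgf_def using integrable_power_disc[OF assms(1) m assms(3)]
    by (subst Bochner_Integration.integral_diff) (auto simp: prob_space)
  also have "\<dots> = (z - 1) * (\<integral>k. (\<Sum>j<k. z ^ j) \<partial>\<mu>)"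
    by (simp add: power_diff_1_eq)
  finally show ?thesis .
qed

lemma char_eq_pgf:
  assumes "sets \<mu> = UNIV"
  shows "char (distr \<mu> borel real) t = pgf \<mu> (iexp t)"
proof -
  have m: "real \<in> borel_measurable \<mu>"
    using assms sets_eq_imp_space_eq[of \<mu> "count_space UNIV"] by (auto simp: measurable_def)
  have "char (distr \<mu> borel real) t = (\<integral>k. iexp (t * real k) \<partial>\<mu>)"
    unfolding char_def by (subst integral_distr[OF m]) auto
  also have "\<dots> = pgf \<mu> (iexp t)"
    unfolding pgf_def by (intro Bochner_Integration.integral_cong) (auto simp: exp_of_nat_mult[symmetric] mult_ac)
  finally show ?thesis .
qed

text \<open>
  On the unit circle the generating function is the characteristic function, so this is Levy's
  continuity theorem.
\<close>

lemma conv_in_law_if_pgf_tendsto: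
  assumes \<mu>: "\<And>n. 1 \<le> n \<Longrightarrow> prob_space (\<mu> n)" "\<And>n. 1 \<le> n \<Longrightarrow> sets (\<mu> n) = UNIV"
    and \<nu>: "prob_space \<nu>" "sets \<nu> = UNIV"
    and lim: "\<And>z. norm z = 1 \<Longrightarrow> (\<lambda>n. pgf (\<mu> n) z) \<longlonglongrightarrow> pgf \<nu> z"
  shows "conv_in_law \<mu> \<nu>"
proof -
  have rd: "real_distribution (distr \<rho> borel real)" if "prob_space \<rho>" "sets \<rho> = UNIV" for \<rho> :: "nat measure"
    using that sets_eq_imp_space_eq[of \<rho> "count_space UNIV"]
    by (intro prob_space.real_distribution_distr) (auto simp: measurable_def)
  \<comment> \<open>Levy's theorem needs a probability measure at every index, hence the shift past \<open>0\<close>.\<close>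
  have "weak_conv_m (\<lambda>n. distr (\<mu> (Suc n)) borel real) (distr \<nu> borel real)"
  proof (rule levy_continuity)
    show "(\<lambda>n. char (distr (\<mu> (Suc n)) borel real) t) \<longlonglongrightarrow> char (distr \<nu> borel real) t" for t
      using LIMSEQ_Suc[OF lim[of "iexp t"]] by (simp add: char_eq_pgf \<mu> \<nu> norm_exp_i_times)
  qed (use rd \<mu> \<nu> in auto)
  then show ?thesis
    unfolding conv_in_law_def weak_conv_m_def weak_conv_def
    by (auto intro: LIMSEQ_imp_Suc)
qed

lemma pgf_sum_iid:
  fixes X :: "nat \<Rightarrow> 'a \<Rightarrow> nat"
  assumes "prob_space M" and ind: "prob_space.indep_vars M (\<lambda>_. count_space UNIV) X I"
    and "finite I" and same: "\<And>i. i \<in> I \<Longrightarrow> law M (X i) = \<mu>" and z: "norm z \<le> 1"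
  shows "pgf (law M (\<lambda>\<omega>. \<Sum>i\<in>I. X i \<omega>)) z = pgf \<mu> z ^ card I"
proof -
  interpret prob_space M by fact
  have rv[measurable]: "X i \<in> measurable M (count_space UNIV)" if "i \<in> I" for i
    using ind that by (auto simp: indep_vars_def)
  have "pgf (law M (\<lambda>\<omega>. \<Sum>i\<in>I. X i \<omega>)) z = (\<integral>\<omega>. (\<Prod>i\<in>I. z ^ X i \<omega>) \<partial>M)"
    by (subst pgf_law) (auto simp: power_sum)
  also have "\<dots> = (\<Prod>i\<in>I. \<integral>\<omega>. z ^ X i \<omega> \<partial>M)"
    using rv assms(1) z
    by (intro indep_vars_lebesgue_integral indep_vars_compose2[OF ind] integrable_power_disc \<open>finite I\<close>) auto
  also have "\<dots> = (\<Prod>i\<in>I. pgf \<mu> z)"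
    by (intro prod.cong) (auto simp: pgf_law[symmetric] rv same)
  finally show ?thesis by simp
qed

section \<open>Generating functions of thinned and Poisson laws\<close>

lemma bernoulli_product_prob_space:
  "product_prob_space (\<lambda>_::nat. measure_pmf (bernoulli_pmf a))"
  by (intro product_prob_spaceI prob_space_measure_pmf)

text \<open>
  The number of summands is random but discrete, so measurability may be checked for each fixed
  value of it.
\<close>

lemma thinning_measurable [measurable]:
  assumes "sets \<mu> = UNIV"
  shows "(\<lambda>(z, B). \<Sum>i = 1..z. of_bool (B i) :: nat) \<in>
    measurable (\<mu> \<Otimes>\<^sub>M (\<Pi>\<^sub>M i\<in>(UNIV :: nat set). measure_pmf (bernoulli_pmf a))) (count_space UNIV)"
proof -
  let ?B = "\<Pi>\<^sub>M i\<in>(UNIV :: nat set). measure_pmf (bernoulli_pmf a)"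
  have "(\<lambda>p. \<Sum>i = 1..fst p. of_bool (snd p i) :: nat) \<in>
    measurable (count_space UNIV \<Otimes>\<^sub>M ?B) (count_space UNIV)"
    by (rule measurable_compose_countable[where g = fst]) measurable
  moreover have "sets (\<mu> \<Otimes>\<^sub>M ?B) = sets (count_space UNIV \<Otimes>\<^sub>M ?B)"
    by (intro sets_pair_measure_cong) (auto simp: assms)
  ultimately show ?thesis
    unfolding case_prod_unfold using measurable_cong_sets[OF _ refl] by blast
qed

lemma thinning_prob_space:
  assumes "prob_space \<mu>" "sets \<mu> = UNIV"
  shows "prob_space (thinning a \<mu>)"
proof -
  interpret product_prob_space "\<lambda>_::nat. measure_pmf (bernoulli_pmf a)" UNIV
    by (rule bernoulli_product_prob_space)
  interpret mu: prob_space \<mu> by fact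
  interpret pair: pair_prob_space \<mu> "\<Pi>\<^sub>M i\<in>(UNIV :: nat set). measure_pmf (bernoulli_pmf a)" ..
  show ?thesis
    unfolding thinning_def by (intro pair.prob_space_distr thinning_measurable assms)
qed

lemma sets_thinning: "sets (thinning a \<mu>) = UNIV"
  by (simp add: thinning_def)

text \<open>
  Given the value \<open>k\<close> of the unthinned variable, the thinned one is a sum of \<open>k\<close> independent
  Bernoulli variables, with generating function \<open>(1 + a (z - 1)) ^ k\<close>; Fubini's theorem then
  averages over \<open>k\<close>.
\<close>

lemma pgf_thinning:
  assumes \<mu>: "prob_space \<mu>" "sets \<mu> = UNIV" and a: "a \<in> {0..1}" and z: "norm z \<le> 1"
  shows "pgf (thinning a \<mu>) z = pgf \<mu> (1 + of_real a * (z - 1))"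
proof -
  interpret product_prob_space "\<lambda>_::nat. measure_pmf (bernoulli_pmf a)" UNIV
    by (rule bernoulli_product_prob_space)
  interpret mu: prob_space \<mu> by fact
  let ?B = "\<Pi>\<^sub>M i\<in>(UNIV :: nat set). measure_pmf (bernoulli_pmf a)"
  interpret pair: pair_prob_space \<mu> ?B ..
  have bern: "(\<integral>b. z ^ of_bool b \<partial>measure_pmf (bernoulli_pmf a)) = 1 + of_real a * (z - 1)"
    using a by (subst integral_measure_pmf[of UNIV]) (auto simp: UNIV_bool algebra_simps scaleR_conv_of_real)
  \<comment> \<open>Only the first \<open>k\<close> coordinates matter, which reduces to a finite product measure.\<close>
  have inner: "(\<integral>B. z ^ (\<Sum>i = 1..k. of_bool (B i)) \<partial>?B) = (1 + of_real a * (z - 1)) ^ k" for k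
  proof -
    let ?J = "{1..k}"
    have "(\<integral>B. z ^ (\<Sum>i\<in>?J. of_bool (B i)) \<partial>?B)
        = (\<integral>B. (\<Prod>i\<in>?J. z ^ of_bool (restrict B ?J i)) \<partial>?B)"
      by (intro Bochner_Integration.integral_cong refl) (simp add: power_sum del: sum_of_bool_eq)
    also have "\<dots> = (\<integral>B. (\<Prod>i\<in>?J. z ^ of_bool (B i))
        \<partial>distr ?B (\<Pi>\<^sub>M i\<in>?J. measure_pmf (bernoulli_pmf a)) (\<lambda>B. restrict B ?J))"
      by (subst integral_distr) auto
    also have "\<dots> = (\<integral>B. (\<Prod>i\<in>?J. z ^ of_bool (B i)) \<partial>(\<Pi>\<^sub>M i\<in>?J. measure_pmf (bernoulli_pmf a)))"
      by (subst distr_PiM_restrict_finite) auto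
    also have "\<dots> = (\<Prod>i\<in>?J. (\<integral>b. z ^ of_bool b \<partial>measure_pmf (bernoulli_pmf a)))"
      using z by (intro product_integral_prod integrable_power_disc prob_space_measure_pmf) auto
    finally show ?thesis by (simp add: bern)
  qed
  have "pgf (thinning a \<mu>) z =
      (\<integral>p. z ^ (case p of (k, B) \<Rightarrow> \<Sum>i = 1..k. of_bool (B i)) \<partial>(\<mu> \<Otimes>\<^sub>M ?B))"
    unfolding thinning_def by (intro pgf_law thinning_measurable \<mu>)
  also have "\<dots> = (\<integral>k. (\<integral>B. z ^ (\<Sum>i = 1..k. of_bool (B i)) \<partial>?B) \<partial>\<mu>)"
    using integrable_power_disc[OF pair.prob_space_axioms thinning_measurable[OF \<mu>(2)] z]
    by (subst pair.integral_fst'[symmetric]) auto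
  also have "\<dots> = pgf \<mu> (1 + of_real a * (z - 1))"
    unfolding pgf_def inner ..
  finally show ?thesis .
qed

lemma pgf_poisson_law:
  assumes "0 \<le> c"
  shows "pgf (poisson_law c) z = exp (of_real c * (z - 1))"
proof (cases "c = 0")
  case True
  then show ?thesis by (simp add: poisson_law_def pgf_def integral_measure_pmf[of "{0}"])
next
  case False
  with assms have c: "0 < c" by simp
  have *: "(\<lambda>k. pmf (poisson_pmf c) k *\<^sub>R z ^ k) =
      (\<lambda>k. of_real (exp (- c)) * ((of_real c * z) ^ k /\<^sub>R fact k))"
    using c by (auto simp: fun_eq_iff scaleR_conv_of_real power_mult_distrib field_simps)
  have sm: "(\<lambda>k. pmf (poisson_pmf c) k *\<^sub>R z ^ k) sums (of_real (exp (- c)) * exp (of_real c * z))"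
    unfolding * by (intro sums_mult exp_converges)
  have int: "integrable (count_space UNIV) (\<lambda>k. pmf (poisson_pmf c) k *\<^sub>R z ^ k)"
    unfolding integrable_count_space_nat_iff *
    using summable_mult[OF summable_norm_exp, of "exp (-c)" "of_real c * z"] by (simp add: norm_mult mult.left_commute)
  have "pgf (poisson_law c) z = (\<integral>k. pmf (poisson_pmf c) k *\<^sub>R z ^ k \<partial>count_space UNIV)"
    using c by (simp add: poisson_law_def pgf_def measure_pmf_eq_density integral_density)
  also have "\<dots> = of_real (exp (- c)) * exp (of_real c * z)"
    using sums_integral_count_space_nat[OF int] sm by (rule sums_unique2)
  also have "\<dots> = exp (of_real c * (z - 1))"
    by (simp add: exp_of_real[symmetric] exp_add[symmetric] algebra_simps)
  finally show ?thesis .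
qed

section \<open>Powers tending to an exponential\<close>

text \<open>
  A complex form of \<open>(1 + c\<^sub>n / n) ^ n \<longrightarrow> exp c\<close> for \<open>c\<^sub>n \<longrightarrow> c\<close>
  that avoids the complex logarithm.  On the unit
  disc the \<open>n\<close>-th power is \<open>n\<close>-Lipschitz, so \<open>\<phi> n\<close> may be compared with \<open>exp (c / n)\<close>, which lies
  in the disc because \<open>Re c \<le> 0\<close>: both differ from \<open>1 + c / n\<close> by \<open>o(1 / n)\<close>.
\<close>

lemma power_tendsto_exp:
  fixes \<phi> :: "nat \<Rightarrow> complex"
  assumes bound: "eventually (\<lambda>n. norm (\<phi> n) \<le> 1) sequentially"
    and lim: "(\<lambda>n. of_nat n * (\<phi> n - 1)) \<longlonglongrightarrow> c" and c: "Re c \<le> 0"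
  shows "(\<lambda>n. \<phi> n ^ n) \<longlonglongrightarrow> exp c"
proof -
  define e where "e n = exp (c / of_nat n)" for n
  have "((\<lambda>h. exp (c * h)) has_field_derivative c) (at 0)"
    by (auto intro!: derivative_eq_intros)
  then have "((\<lambda>h. (exp (c * h) - 1) / h) \<longlongrightarrow> c) (at 0)"
    unfolding has_field_derivative_iff by simp
  moreover have "filterlim (\<lambda>n. inverse (of_nat n) :: complex) (at 0) sequentially"
    unfolding filterlim_inverse_at_iff by (rule tendsto_of_nat)
  ultimately have "(\<lambda>n. (exp (c * inverse (of_nat n)) - 1) / inverse (of_nat n)) \<longlonglongrightarrow> c"
    by (rule filterlim_compose)
  then have "(\<lambda>n. of_nat n * (e n - 1)) \<longlonglongrightarrow> c"
    by (simp add: e_def divide_inverse mult.commute)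
  from tendsto_norm[OF tendsto_diff[OF lim this]]
  have "(\<lambda>n. norm (of_nat n * (\<phi> n - e n))) \<longlonglongrightarrow> 0"
    by (simp add: algebra_simps)
  then have 0: "(\<lambda>n. real n * norm (\<phi> n - e n)) \<longlonglongrightarrow> 0"
    by (simp add: norm_mult)
  have "(\<lambda>n. \<phi> n ^ n - exp c) \<longlonglongrightarrow> 0"
  proof (rule tendsto_0_le[OF 0, where K = 1])
    show "\<forall>\<^sub>F n in sequentially. norm (\<phi> n ^ n - exp c) \<le> norm (real n * norm (\<phi> n - e n)) * 1"
      using bound eventually_gt_at_top[of 0]
    proof eventually_elim
      case (elim n)
      have "e n ^ n = exp c"
        using elim by (simp add: e_def exp_of_nat_mult[symmetric])
      moreover have "norm (e n) \<le> 1"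
        using c by (simp add: e_def Re_divide_of_nat divide_nonpos_nonneg)
      ultimately show ?case
        using norm_power_diff[of "\<phi> n" "e n" n] elim by simp
    qed
  qed
  then show ?thesis by (simp add: LIM_zero_iff)
qed

section \<open>Convergence of means of geometric sums\<close>

lemma nat_measure_eq_density:
  fixes \<mu> :: "nat measure"
  assumes "prob_space \<mu>" "sets \<mu> = UNIV"
  shows "\<mu> = density (count_space UNIV) (\<lambda>k. ennreal (measure \<mu> {k}))"
proof -
  interpret prob_space \<mu> by fact
  show ?thesis
    by (rule measure_eqI_countable[where A = UNIV])
       (auto simp: assms emeasure_density emeasure_eq_measure)
qed

text \<open>
  The limiting distribution function is continuous off the integers, so it is the limit at the
  half-integers \<open>k - 1/2\<close> and \<open>k + 1/2\<close>, whose difference is the mass of \<open>k\<close>.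
\<close>

lemma conv_in_law_point_masses:
  assumes \<mu>: "\<And>n. prob_space (\<mu> n)" "\<And>n. sets (\<mu> n) = UNIV"
    and \<nu>: "prob_space \<nu>" "sets \<nu> = UNIV"
    and conv: "conv_in_law \<mu> \<nu>"
  shows "(\<lambda>n. measure (\<mu> n) {k}) \<longlonglongrightarrow> measure \<nu> {k}"
proof -
  have m: "real \<in> borel_measurable \<rho>" if "sets \<rho> = UNIV" for \<rho> :: "nat measure"
    using that sets_eq_imp_space_eq[of \<rho> "count_space UNIV"] by (auto simp: measurable_def)
  have sp: "space \<rho> = UNIV" if "sets \<rho> = UNIV" for \<rho> :: "nat measure"
    using that sets_eq_imp_space_eq[of \<rho> "count_space UNIV"] by auto
  define h where "h = real k + 1 / 2"
  have cdf: "cdf (distr \<rho> borel real) x = measure \<rho> {j. real j \<le> x}" if "sets \<rho> = UNIV" for \<rho> x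
    unfolding cdf_def2 by (subst measure_distr[OF m[OF that]]) (auto simp: sp that vimage_def)
  have mass: "measure \<rho> {k} = cdf (distr \<rho> borel real) h - cdf (distr \<rho> borel real) (h - 1)"
    if \<rho>: "prob_space \<rho>" "sets \<rho> = UNIV" for \<rho>
  proof -
    interpret prob_space \<rho> by fact
    have "measure \<rho> ({j. real j \<le> h} - {j. real j \<le> h - 1})
        = measure \<rho> {j. real j \<le> h} - measure \<rho> {j. real j \<le> h - 1}"
      by (rule finite_measure_Diff) (auto simp: \<rho>)
    moreover have "{j. real j \<le> h} - {j. real j \<le> h - 1} = {k}"
      unfolding h_def by auto
    ultimately show ?thesis by (simp add: cdf \<rho>)
  qed
  interpret D: real_distribution "distr \<nu> borel real"
    using \<nu> m by (intro prob_space.real_distribution_distr)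
  have lim: "(\<lambda>n. cdf (distr (\<mu> n) borel real) x) \<longlonglongrightarrow> cdf (distr \<nu> borel real) x"
    if x: "x \<notin> range real" for x
  proof -
    have "real -` {x} = {}" using x by auto
    then have "measure (distr \<nu> borel real) {x} = 0"
      by (subst measure_distr[OF m[OF \<nu>(2)]]) auto
    then have "isCont (cdf (distr \<nu> borel real)) x" by (simp add: D.isCont_cdf)
    then show ?thesis
      using conv by (auto simp: conv_in_law_def weak_conv_m_def weak_conv_def)
  qed
  have half: "h \<noteq> real j" "h - 1 \<noteq> real j" for j
  proof -
    have "2 * k + 1 \<noteq> 2 * j" "2 * k \<noteq> 2 * j + 1" by presburger+
    then show "h \<noteq> real j" "h - 1 \<noteq> real j"
      unfolding h_def by (auto simp: field_simps simp flip: of_nat_eq_iff[where 'a = real])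
  qed
  show ?thesis
    unfolding mass[OF \<mu>] mass[OF \<nu>] using half by (intro tendsto_diff lim) auto
qed

text \<open>
  Write \<open>p n\<close> and \<open>q\<close> for the mass functions of \<open>\<mu> n\<close> and \<open>\<nu>\<close>, and \<open>G n k\<close> for the geometric sum,
  so that \<open>G n k\<close> is bounded by \<open>k\<close> and tends to \<open>k\<close>.  No integrable function need dominate every
  \<open>G n k * p n k\<close>, so \<open>p n\<close> is first replaced by \<open>q\<close>, at a cost of at most the \<open>L\<^sup>1\<close> distance of
  \<open>k * p n k\<close> and \<open>k * q k\<close>, which vanishes by Scheffe's lemma; then \<open>k * q k\<close> dominates
  \<open>G n k * q k\<close>.
\<close>

lemma geometric_sum_mean_tendsto:
  fixes z :: "nat \<Rightarrow> complex"
  assumes \<mu>: "\<And>n. prob_space (\<mu> n)" "\<And>n. sets (\<mu> n) = UNIV"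
    and \<nu>: "prob_space \<nu>" "sets \<nu> = UNIV"
    and conv: "conv_in_law \<mu> \<nu>"
    and fin: "\<And>n. (\<integral>\<^sup>+k. ennreal (real k) \<partial>\<mu> n) < \<infinity>" "integrable \<nu> real"
    and mean: "(\<lambda>n. \<integral>\<^sup>+k. ennreal (real k) \<partial>\<mu> n) \<longlonglongrightarrow> (\<integral>\<^sup>+k. ennreal (real k) \<partial>\<nu>)"
    and z: "\<And>n. norm (z n) \<le> 1" "z \<longlonglongrightarrow> 1"
  shows "(\<lambda>n. \<integral>k. (\<Sum>j<k. z n ^ j) \<partial>\<mu> n) \<longlonglongrightarrow> of_real (\<integral>k. real k \<partial>\<nu>)"
proof -
  let ?C = "count_space (UNIV :: nat set)"
  define p where "p n k = measure (\<mu> n) {k}" for n k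
  define q where "q k = measure \<nu> {k}" for k
  define G where "G n k = (\<Sum>j<k. z n ^ j)" for n k
  have nn: "(\<integral>\<^sup>+k. ennreal (real k) \<partial>\<mu> n) = (\<integral>\<^sup>+k. ennreal (real k * p n k) \<partial>?C)" for n
    by (subst nat_measure_eq_density[OF \<mu>])
       (simp add: nn_integral_density p_def ennreal_mult' mult.commute)
  have nn': "(\<integral>\<^sup>+k. ennreal (real k) \<partial>\<nu>) = (\<integral>\<^sup>+k. ennreal (real k * q k) \<partial>?C)"
    by (subst nat_measure_eq_density[OF \<nu>])
       (simp add: nn_integral_density q_def ennreal_mult' mult.commute)
  have p0: "0 \<le> p n k" "0 \<le> q k" for n k by (auto simp: p_def q_def)
  have int_p: "integrable ?C (\<lambda>k. real k * p n k)" for n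
    using fin(1)[of n] p0 unfolding nn integrable_iff_bounded by simp
  have int_q: "integrable ?C (\<lambda>k. real k * q k)"
    using fin(2) unfolding integrable_iff_bounded
    by (simp add: nn' p0)
  have "(\<lambda>n. \<integral>\<^sup>+k. norm (real k * p n k - real k * q k) \<partial>?C) \<longlonglongrightarrow> 0"
  proof (rule Scheffe_lemma1[OF int_p int_q])
    show "AE k in ?C. (\<lambda>n. real k * p n k) \<longlonglongrightarrow> real k * q k"
      unfolding p_def q_def
      by (intro AE_I2 tendsto_mult_left conv_in_law_point_masses assms)
    have "limsup (\<lambda>n. \<integral>\<^sup>+k. norm (real k * p n k) \<partial>?C) = (\<integral>\<^sup>+k. norm (real k * q k) \<partial>?C)"
      using mean p0 by (intro lim_imp_Limsup) (simp_all add: nn nn')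
    then show "limsup (\<lambda>n. \<integral>\<^sup>+k. norm (real k * p n k) \<partial>?C) \<le> (\<integral>\<^sup>+k. norm (real k * q k) \<partial>?C)"
      by simp
  qed
  then have L1: "(\<lambda>n. \<integral>k. norm (real k * p n k - real k * q k) \<partial>?C) \<longlonglongrightarrow> 0"
    by (subst (asm) nn_integral_eq_integral)
       (auto intro!: Bochner_Integration.integrable_diff int_p int_q integrable_norm
         simp: ennreal_0[symmetric] tendsto_ennreal_iff simp del: ennreal_0)
  have G_le: "norm (G n k) \<le> real k" for n k
    unfolding G_def using sum_norm_bound[of "{..<k}" "\<lambda>j. z n ^ j" 1]
    by (simp add: norm_power power_le_one z)
  have int_Gp: "integrable ?C (\<lambda>k. G n k * of_real (p n k))" for n
    by (rule Bochner_Integration.integrable_bound[OF int_p[of n]])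
       (auto simp: norm_mult p0 intro!: mult_right_mono G_le)
  have int_Gq: "integrable ?C (\<lambda>k. G n k * of_real (q k))" for n
    by (rule Bochner_Integration.integrable_bound[OF int_q])
       (auto simp: norm_mult p0 intro!: mult_right_mono G_le)
  have A: "(\<lambda>n. \<integral>k. G n k * of_real (p n k) - G n k * of_real (q k) \<partial>?C) \<longlonglongrightarrow> 0"
  proof (rule tendsto_0_le[OF L1, where K = 1], intro always_eventually allI)
    fix n
    have "norm (\<integral>k. G n k * of_real (p n k) - G n k * of_real (q k) \<partial>?C)
        \<le> (\<integral>k. norm (G n k * of_real (p n k) - G n k * of_real (q k)) \<partial>?C)"
      by (rule integral_norm_bound)
    also have "\<dots> \<le> (\<integral>k. norm (real k * p n k - real k * q k) \<partial>?C)"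
    proof (rule integral_mono)
      fix k
      have "norm (G n k * of_real (p n k) - G n k * of_real (q k)) = norm (G n k) * \<bar>p n k - q k\<bar>"
        unfolding right_diff_distrib[symmetric] of_real_diff[symmetric] norm_mult norm_of_real ..
      also have "\<dots> \<le> real k * \<bar>p n k - q k\<bar>"
        by (intro mult_right_mono G_le) auto
      also have "\<dots> = norm (real k * p n k - real k * q k)"
        by (simp add: right_diff_distrib[symmetric] abs_mult)
      finally show "norm (G n k * of_real (p n k) - G n k * of_real (q k))
          \<le> norm (real k * p n k - real k * q k)" .
    qed (auto intro!: integrable_norm Bochner_Integration.integrable_diff int_Gp int_Gq int_p int_q)
    finally show "norm (\<integral>k. G n k * of_real (p n k) - G n k * of_real (q k) \<partial>?C)
        \<le> norm (\<integral>k. norm (real k * p n k - real k * q k) \<partial>?C) * 1"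
      by simp
  qed
  have B: "(\<lambda>n. \<integral>k. G n k * of_real (q k) \<partial>?C) \<longlonglongrightarrow> (\<integral>k. of_real (real k * q k) \<partial>?C)"
  proof (rule integral_dominated_convergence[where w = "\<lambda>k. real k * q k"])
    show "AE k in ?C. (\<lambda>n. G n k * of_real (q k)) \<longlonglongrightarrow> of_real (real k * q k)"
    proof (rule AE_I2)
      fix k
      have "(\<lambda>n. G n k) \<longlonglongrightarrow> (\<Sum>j<k. 1 ^ j)"
        unfolding G_def by (intro tendsto_sum tendsto_power z)
      then show "(\<lambda>n. G n k * of_real (q k)) \<longlonglongrightarrow> of_real (real k * q k)"
        by (auto intro!: tendsto_mult)
    qed
  qed (auto simp: norm_mult p0 int_q intro!: mult_right_mono G_le)
  have "(\<lambda>n. \<integral>k. G n k * of_real (p n k) \<partial>?C) \<longlonglongrightarrow> of_real (\<integral>k. real k * q k \<partial>?C)"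
    using tendsto_add[OF A B[unfolded integral_complex_of_real]] by (simp add: Bochner_Integration.integral_diff int_Gp int_Gq)
  moreover have "(\<integral>k. G n k \<partial>\<mu> n) = (\<integral>k. G n k * of_real (p n k) \<partial>?C)" for n
    by (subst nat_measure_eq_density[OF \<mu>])
       (simp add: integral_density p_def scaleR_conv_of_real mult.commute)
  moreover have "(\<integral>k. real k \<partial>\<nu>) = (\<integral>k. real k * q k \<partial>?C)"
    by (subst nat_measure_eq_density[OF \<nu>])
       (simp add: integral_density q_def mult.commute)
  ultimately show ?thesis
    by (simp add: G_def)
qed

section \<open>Poisson limit for thinned sums\<close>

theorem theorem7:
  fixes M :: "nat \<Rightarrow> 'a measure" and X :: "nat \<Rightarrow> nat \<Rightarrow> 'a \<Rightarrow> nat"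
    and P :: "'b measure" and Y :: "'b \<Rightarrow> nat"
    and a :: "nat \<Rightarrow> real" and l :: real
  assumes "\<And>n. 1 \<le> n \<Longrightarrow> prob_space (M n)"
    and "\<And>n. 1 \<le> n \<Longrightarrow>
           prob_space.indep_vars (M n) (\<lambda>_. count_space UNIV) (\<lambda>k. X k n) {1..n}"
    and "\<And>n k. 1 \<le> n \<Longrightarrow> k \<in> {1..n} \<Longrightarrow> law (M n) (X k n) = law (M n) (X 1 n)"
    and "prob_space P"
    and "Y \<in> measurable P (count_space UNIV)"
    and "conv_in_law (\<lambda>n. law (M n) (X 1 n)) (law P Y)"
    and "integrable P (\<lambda>\<omega>. real (Y \<omega>))"
    and "(\<lambda>n. \<integral>\<^sup>+\<omega>. ennreal (real (X 1 n \<omega>)) \<partial>M n) \<longlonglongrightarrow> (\<integral>\<^sup>+\<omega>. ennreal (real (Y \<omega>)) \<partial>P)"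
    and "\<And>n. 1 \<le> n \<Longrightarrow> a n \<in> {0..1}"
    and "(\<lambda>n. real n * a n) \<longlonglongrightarrow> l"
    and "0 < l"
  shows "conv_in_law
           (\<lambda>n. thinning (a n) (law (M n) (\<lambda>\<omega>. \<Sum>k = 1..n. X k n \<omega>)))
           (poisson_law (l * prob_space.expectation P (\<lambda>\<omega>. real (Y \<omega>))))"
proof -
  let ?E = "prob_space.expectation P (\<lambda>\<omega>. real (Y \<omega>))"
  let ?\<mu> = "\<lambda>n. law (M n) (X 1 n)"
  let ?S = "\<lambda>n. law (M n) (\<lambda>\<omega>. \<Sum>k = 1..n. X k n \<omega>)"
  note prob = assms(1) and indep = assms(2) and same = assms(3) and Y = assms(5)
  have X[measurable]: "X k n \<in> measurable (M n) (count_space UNIV)" if "1 \<le> n" "k \<in> {1..n}" for k n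
    using indep[OF that(1)] that by (simp add: prob_space.indep_vars_def[OF prob])
  have X1: "X 1 n \<in> measurable (M n) (count_space UNIV)" if "1 \<le> n" for n
    using that by (intro X) auto
  have S: "(\<lambda>\<omega>. \<Sum>k = 1..n. X k n \<omega>) \<in> measurable (M n) (count_space UNIV)" if "1 \<le> n" for n
    using that by measurable
  have E: "?E = (\<integral>k. real k \<partial>law P Y)" "0 \<le> ?E"
    using Y by (auto simp: integral_distr)
  show ?thesis
  proof (rule conv_in_law_if_pgf_tendsto)
    fix n :: nat assume n: "1 \<le> n"
    show "prob_space (thinning (a n) (?S n))"
      using n S prob by (intro thinning_prob_space prob_space.prob_space_distr) auto
    show "sets (thinning (a n) (?S n)) = UNIV" by (rule sets_thinning)
  next
    show "prob_space (poisson_law (l * ?E))" "sets (poisson_law (l * ?E)) = UNIV"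
      by (auto simp: poisson_law_def prob_space_measure_pmf)
  next
    fix z :: complex assume z: "norm z = 1"
    define u where "u n = 1 + of_real (a n) * (z - 1)" for n
    \<comment> \<open>\<open>u n\<close> is a convex combination of \<open>1\<close> and \<open>z\<close>.\<close>
    have u_le: "norm (u n) \<le> 1" if "1 \<le> n" for n
    proof -
      have "u n = of_real (1 - a n) + of_real (a n) * z" by (simp add: u_def algebra_simps)
      also have "norm \<dots> \<le> norm (of_real (1 - a n) :: complex) + norm (of_real (a n) * z)"
        by (rule norm_triangle_ineq)
      also have "\<dots> = 1" using assms(9)[OF that] z by (simp add: norm_mult del: of_real_diff)
      finally show ?thesis .
    qed
    have "a \<longlonglongrightarrow> 0"
    proof -
      have "(\<lambda>n. real n * a n * inverse (real n)) \<longlonglongrightarrow> l * 0"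
        using assms(10) by (intro tendsto_mult) (auto intro: lim_inverse_n)
      moreover have "eventually (\<lambda>n. real n * a n * inverse (real n) = a n) sequentially"
        using eventually_gt_at_top[of 0] by eventually_elim auto
      ultimately show ?thesis by (simp add: tendsto_cong)
    qed
    then have u_lim: "u \<longlonglongrightarrow> 1"
      unfolding u_def by (auto intro!: tendsto_eq_intros)
    have nn: "(\<integral>\<^sup>+k. ennreal (real k) \<partial>?\<mu> n) = (\<integral>\<^sup>+\<omega>. ennreal (real (X 1 n \<omega>)) \<partial>M n)"
      if "1 \<le> n" for n
      using X1[OF that] by (subst nn_integral_distr) auto
    have nnY: "(\<integral>\<^sup>+k. ennreal (real k) \<partial>law P Y) = (\<integral>\<^sup>+\<omega>. ennreal (real (Y \<omega>)) \<partial>P)"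
      using Y by (subst nn_integral_distr) auto
    have "(\<integral>\<^sup>+\<omega>. ennreal (real (Y \<omega>)) \<partial>P) < \<infinity>"
      using assms(7) by (simp add: integrable_iff_bounded)
    from order_tendstoD(2)[OF assms(8) this]
    obtain N0 where N0: "\<And>n. N0 \<le> n \<Longrightarrow> (\<integral>\<^sup>+\<omega>. ennreal (real (X 1 n \<omega>)) \<partial>M n) < \<infinity>"
      by (auto simp: eventually_sequentially)
    \<comment> \<open>The means converge to a finite limit but may be infinite at first, and nothing is known about
      index \<open>0\<close>; the shift by \<open>N\<close> skips those indices.\<close>
    define N where "N = max 1 N0"
    have N: "1 \<le> n + N" "N0 \<le> n + N" for n by (auto simp: N_def)
    have "(\<lambda>n. \<integral>k. (\<Sum>j<k. u (n + N) ^ j) \<partial>?\<mu> (n + N)) \<longlonglongrightarrow> of_real (\<integral>k. real k \<partial>law P Y)"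
    proof (rule geometric_sum_mean_tendsto)
      show "prob_space (?\<mu> (n + N))" for n
        using prob X1 N by (intro prob_space.prob_space_distr) auto
      show "prob_space (law P Y)" using assms(4) Y by (intro prob_space.prob_space_distr)
      show "conv_in_law (\<lambda>n. ?\<mu> (n + N)) (law P Y)"
        using assms(6) by (auto simp: conv_in_law_def weak_conv_m_def weak_conv_def intro: LIMSEQ_ignore_initial_segment)
      show "(\<integral>\<^sup>+k. ennreal (real k) \<partial>?\<mu> (n + N)) < \<infinity>" for n
        unfolding nn[OF N(1)] by (rule N0[OF N(2)])
      show "integrable (law P Y) real" using assms(7) Y by (subst integrable_distr_eq) auto
      show "(\<lambda>n. \<integral>\<^sup>+k. ennreal (real k) \<partial>?\<mu> (n + N)) \<longlonglongrightarrow> (\<integral>\<^sup>+k. ennreal (real k) \<partial>law P Y)"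
        unfolding nn[OF N(1)] nnY by (rule LIMSEQ_ignore_initial_segment[OF assms(8)])
      show "(\<lambda>n. u (n + N)) \<longlonglongrightarrow> 1" by (rule LIMSEQ_ignore_initial_segment[OF u_lim])
      show "norm (u (n + N)) \<le> 1" for n by (rule u_le[OF N(1)])
    qed auto
    then have mean: "(\<lambda>n. \<integral>k. (\<Sum>j<k. u n ^ j) \<partial>?\<mu> n) \<longlonglongrightarrow> of_real ?E"
      unfolding E(1)[symmetric] by (rule LIMSEQ_offset)
    have "(\<lambda>n. of_real (real n * a n) * (z - 1) * (\<integral>k. (\<Sum>j<k. u n ^ j) \<partial>?\<mu> n))
        \<longlonglongrightarrow> of_real l * (z - 1) * of_real ?E"
      by (intro tendsto_mult tendsto_of_real mean assms(10) tendsto_const)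
    moreover have "eventually (\<lambda>n. of_real (real n * a n) * (z - 1) * (\<integral>k. (\<Sum>j<k. u n ^ j) \<partial>?\<mu> n)
        = of_nat n * (pgf (?\<mu> n) (u n) - 1)) sequentially"
      using eventually_ge_at_top[of 1]
    proof eventually_elim
      case (elim n)
      have "prob_space (?\<mu> n)" using elim prob X1 by (intro prob_space.prob_space_distr) auto
      from pgf_diff_1[OF this _ u_le[OF elim]] show ?case by (simp add: u_def)
    qed
    ultimately have "(\<lambda>n. of_nat n * (pgf (?\<mu> n) (u n) - 1)) \<longlonglongrightarrow> of_real l * (z - 1) * of_real ?E"
      by (rule Lim_transform_eventually)
    then have "(\<lambda>n. pgf (?\<mu> n) (u n) ^ n) \<longlonglongrightarrow> exp (of_real l * (z - 1) * of_real ?E)"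
    proof (rule power_tendsto_exp[rotated])
      show "eventually (\<lambda>n. norm (pgf (?\<mu> n) (u n)) \<le> 1) sequentially"
        using eventually_ge_at_top[of 1]
      proof eventually_elim
        case (elim n)
        then show ?case
          using prob X1 u_le by (intro norm_pgf_le_1 prob_space.prob_space_distr) auto
      qed
      have "Re z \<le> 1" using complex_Re_le_cmod[of z] z by simp
      then show "Re (of_real l * (z - 1) * of_real ?E) \<le> 0"
        using assms(11) E(2) by (simp add: mult_nonneg_nonpos mult_nonpos_nonneg)
    qed
    moreover have "eventually (\<lambda>n. pgf (?\<mu> n) (u n) ^ n = pgf (thinning (a n) (?S n)) z) sequentially"
      using eventually_ge_at_top[of 1]
    proof eventually_elim
      case (elim n)
      have "pgf (thinning (a n) (?S n)) z = pgf (?S n) (u n)"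
        unfolding u_def using elim z prob S assms(9)
        by (intro pgf_thinning prob_space.prob_space_distr) auto
      also have "\<dots> = pgf (?\<mu> n) (u n) ^ n"
        using pgf_sum_iid[OF prob indep _ same u_le] elim by simp
      finally show ?case ..
    qed
    ultimately have "(\<lambda>n. pgf (thinning (a n) (?S n)) z) \<longlonglongrightarrow> exp (of_real l * (z - 1) * of_real ?E)"
      by (rule Lim_transform_eventually)
    also have "exp (of_real l * (z - 1) * of_real ?E) = pgf (poisson_law (l * ?E)) z"
      using assms(11) E(2) by (subst pgf_poisson_law) (auto simp: mult_ac)
    finally show "(\<lambda>n. pgf (thinning (a n) (?S n)) z) \<longlonglongrightarrow> pgf (poisson_law (l * ?E)) z" .
  qed
qed

end
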